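(* Let $\mathcal{C}$ be a class of matroids closed under restriction and let $\mathbf{BigM}$ be a finite matroid. Let $(f_{\mathbf{M},\pi})$ be an online matroid morphism of $\mathcal{C}$ into $\mathbf{BigM}$ such that for every $\mathbf{M}\in\mathcal{C}$ and any two orderings $\pi,\pi'$ of the ground set of $\mathbf{M}$, there is an automorphism $A\in\mathrm{Aut}(\mathbf{BigM})$ with $f_{\mathbf{M},\pi'}=A\circ f_{\mathbf{M},\pi}$. Then there is an order-independent randomized online matroid morphism of $\mathcal{C}$ into $\mathbf{BigM}$.
   Context: Matroids have finite ground sets, denoted by the same letter as the matroid. A morphism $f:\mathbf{M}\to\mathbf{N}$ is a map of ground sets with $\mathrm{rank}_{\mathbf{N}}(f(S))=\mathrm{rank}_{\mathbf{M}}(S)$ for all $S$; an automorphism is a bijective morphism from a matroid to itself, and $\mathrm{Aut}(\mathbf{M})$ is the group of automorphisms. An ordering of $\mathbf{M}$ with $|\mathbf{M}|=m$ is a bijection $\pi:[m]\to\mathbf{M}$; for $m'<m$, the prefix-restriction $(\mathbf{M}',\pi')$ of $(\mathbf{M},\pi)$ is the restriction of $\mathbf{M}$ to $\pi([m'])$ with $\pi'=\pi|_{[m']}$. An online matroid morphism (OMM) of $\mathcal{C}$ into $\mathbf{BigM}$ is a family of morphisms $f_{\mathbf{M},\pi}:\mathbf{M}\to\mathbf{BigM}$ for all $\mathbf{M}\in\mathcal{C}$ and orderings $\pi$, such that for every prefix-restriction $(\mathbf{M}',\pi')$ of $(\mathbf{M},\pi)$, $f_{\mathbf{M}',\pi'}$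 is the restriction of $f_{\mathbf{M},\pi}$. A randomized OMM assigns to each $(\mathbf{M},\pi)$ a distribution over morphisms $f_{\mathbf{M},\pi}:\mathbf{M}\to\mathbf{BigM}$ such that the restriction of $f_{\mathbf{M},\pi}$ to any prefix-restriction $(\mathbf{M}',\pi')$ is distributed as $f_{\mathbf{M}',\pi'}$; it is order-independent if the distribution of $f_{\mathbf{M},\pi}$ does not depend on $\pi$. *)

theory Defs
  imports "HOL-Probability.Probability_Mass_Function" "HOL-Library.FuncSet"
begin

record 'a matroid =
  ground :: "'a set"
  indeps :: "'a set set"

locale matroid =
  fixes M :: "'a matroid"
  assumes finite_ground: "finite (ground M)"
    and indeps_subset: "I \<in> indeps M \<Longrightarrow> I \<subseteq> ground M"
    and empty_indep: "{} \<in> indeps M"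
    and indep_mono: "\<lbrakk>J \<in> indeps M; I \<subseteq> J\<rbrakk> \<Longrightarrow> I \<in> indeps M"
    and augment: "\<lbrakk>I \<in> indeps M; J \<in> indeps M; card I < card J\<rbrakk>
                  \<Longrightarrow> \<exists>x\<in>J - I. insert x I \<in> indeps M"

definition matroid_rank :: "'a matroid \<Rightarrow> 'a set \<Rightarrow> nat" where
  "matroid_rank M S = Max (card ` {I \<in> indeps M. I \<subseteq> S})"

definition matroid_restrict :: "'a matroid \<Rightarrow> 'a set \<Rightarrow> 'a matroid" where
  "matroid_restrict M X = \<lparr>ground = X, indeps = {I \<in> indeps M. I \<subseteq> X}\<rparr>"

lemma matroid_restrict_sel [simp]:
  "ground (matroid_restrict M X) = X"
  "indeps (matroid_restrict M X) = {I \<in> indeps M. I \<subseteq> X}"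
  by (simp_all add: matroid_restrict_def)

lemma matroid_matroid_restrict:
  assumes "matroid M" "X \<subseteq> ground M"
  shows "matroid (matroid_restrict M X)"
proof -
  interpret matroid M by fact
  show ?thesis
  proof
    show "finite (ground (matroid_restrict M X))"
      using finite_ground assms(2) by (simp add: finite_subset)
  next
    fix I J
    assume I: "I \<in> indeps (matroid_restrict M X)"
      and J: "J \<in> indeps (matroid_restrict M X)" and "card I < card J"
    then obtain x where "x \<in> J - I" "insert x I \<in> indeps M"
      using augment[of I J] by auto
    with I J show "\<exists>x\<in>J - I. insert x I \<in> indeps (matroid_restrict M X)"
      by auto
  qed (use empty_indep in \<open>auto intro: indep_mono\<close>)
qed

lemma matroid_rank_restrict:
  "S \<subseteq> X \<Longrightarrow> matroid_rank (matroid_restrict M X) S = matroid_rank M S"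
proof -
  assume "S \<subseteq> X"
  then have "{I \<in> indeps (matroid_restrict M X). I \<subseteq> S} = {I \<in> indeps M. I \<subseteq> S}"
    by auto
  then show ?thesis
    by (simp only: matroid_rank_def)
qed

definition closed_under_restriction :: "'a matroid set \<Rightarrow> bool" where
  "closed_under_restriction C \<longleftrightarrow>
     (\<forall>M\<in>C. \<forall>X. X \<subseteq> ground M \<longrightarrow> matroid_restrict M X \<in> C)"

text \<open>Maps between finite sets, including morphisms and orderings, are represented by
  extensional functions (equal to \<^const>\<open>undefined\<close> outside the domain), so that equality of
  HOL functions coincides with equality of maps.\<close>

definition matroid_morphisms :: "'a matroid \<Rightarrow> 'b matroid \<Rightarrow> ('a \<Rightarrow> 'b) set" where
  "matroid_morphisms M N = {f \<in> ground M \<rightarrow>\<^sub>E ground N.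
     \<forall>S. S \<subseteq> ground M \<longrightarrow> matroid_rank N (f ` S) = matroid_rank M S}"

definition Aut :: "'a matroid \<Rightarrow> ('a \<Rightarrow> 'a) set" where
  "Aut M = {A \<in> matroid_morphisms M M. bij_betw A (ground M) (ground M)}"

definition orderings :: "'a matroid \<Rightarrow> (nat \<Rightarrow> 'a) set" where
  "orderings M = {\<pi> \<in> {1..card (ground M)} \<rightarrow>\<^sub>E ground M.
     bij_betw \<pi> {1..card (ground M)} (ground M)}"

definition prefix_restriction ::
    "'a matroid \<Rightarrow> (nat \<Rightarrow> 'a) \<Rightarrow> 'a matroid \<Rightarrow> (nat \<Rightarrow> 'a) \<Rightarrow> bool" where
  "prefix_restriction M' \<pi>' M \<pi> \<longleftrightarrow>
     (\<exists>m' < card (ground M).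
        M' = matroid_restrict M (\<pi> ` {1..m'}) \<and> \<pi>' = restrict \<pi> {1..m'})"

text \<open>The next two notions are meant for classes closed under restriction. Values outside the
  class, or at functions that are not orderings, are irrelevant.\<close>

definition online_morphism ::
    "'a matroid set \<Rightarrow> 'b matroid \<Rightarrow> ('a matroid \<Rightarrow> (nat \<Rightarrow> 'a) \<Rightarrow> 'a \<Rightarrow> 'b) \<Rightarrow> bool" where
  "online_morphism C B f \<longleftrightarrow>
     (\<forall>M\<in>C. \<forall>\<pi>\<in>orderings M.
        f M \<pi> \<in> matroid_morphisms M B \<and>
        (\<forall>M' \<pi>'. prefix_restriction M' \<pi>' M \<pi> \<longrightarrow> f M' \<pi>' = restrict (f M \<pi>) (ground M')))"

text \<open>For a finite target, the set of morphisms from a finite matroid is finite, so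
  every probability distribution on it is a probability mass function.\<close>

definition randomized_online_morphism ::
    "'a matroid set \<Rightarrow> 'b matroid \<Rightarrow> ('a matroid \<Rightarrow> (nat \<Rightarrow> 'a) \<Rightarrow> ('a \<Rightarrow> 'b) pmf) \<Rightarrow> bool" where
  "randomized_online_morphism C B F \<longleftrightarrow>
     (\<forall>M\<in>C. \<forall>\<pi>\<in>orderings M.
        set_pmf (F M \<pi>) \<subseteq> matroid_morphisms M B \<and>
        (\<forall>M' \<pi>'. prefix_restriction M' \<pi>' M \<pi> \<longrightarrow>
           map_pmf (\<lambda>g. restrict g (ground M')) (F M \<pi>) = F M' \<pi>'))"

definition order_independent ::
    "'a matroid set \<Rightarrow> ('a matroid \<Rightarrow> (nat \<Rightarrow> 'a) \<Rightarrow> ('a \<Rightarrow> 'b) pmf) \<Rightarrow> bool" where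
  "order_independent C F \<longleftrightarrow>
     (\<forall>M\<in>C. \<forall>\<pi>\<in>orderings M. \<forall>\<pi>'\<in>orderings M. F M \<pi> = F M \<pi>')"

end

theory Submission
  imports Defs
begin

text \<open>Compose the given morphisms with a uniformly random automorphism \<open>A\<close> of \<open>BigM\<close>, the same
  for all matroids and orderings. Post-composition commutes with restriction, and by hypothesis
  changing the ordering amounts to replacing \<open>A\<close> by \<open>A \<circ> A\<^sub>0\<close> for a fixed automorphism \<open>A\<^sub>0\<close>, which
  preserves the uniform distribution.\<close>

text \<open>Serves twice: for closure of \<open>Aut\<close> under composition, and to see that an
  automorphism of the target applied after a morphism is again a morphism.\<close>

lemma compose_matroid_morphisms:
  assumes "f \<in> matroid_morphisms M N" "g \<in> matroid_morphisms N P"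
  shows "compose (ground M) g f \<in> matroid_morphisms M P"
proof -
  have f: "f \<in> ground M \<rightarrow>\<^sub>E ground N" and g: "g \<in> ground N \<rightarrow>\<^sub>E ground P"
    using assms by (auto simp: matroid_morphisms_def)
  have "matroid_rank P (compose (ground M) g f ` S) = matroid_rank M S"
    if S: "S \<subseteq> ground M" for S
  proof -
    have "compose (ground M) g f ` S = g ` f ` S"
      using S by (force simp: compose_def)
    moreover have "f ` S \<subseteq> ground N"
      using f S by auto
    ultimately show ?thesis
      using assms S by (simp add: matroid_morphisms_def)
  qed
  moreover have "compose (ground M) g f \<in> ground M \<rightarrow>\<^sub>E ground P"
    using f g by (auto simp: compose_def)
  ultimately show ?thesis
    by (simp add: matroid_morphisms_def)
qed

lemma finite_Aut:
  assumes "finite (ground M)"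
  shows "finite (Aut M)"
proof (rule finite_subset)
  show "Aut M \<subseteq> ground M \<rightarrow>\<^sub>E ground M"
    by (auto simp: Aut_def matroid_morphisms_def)
  show "finite (ground M \<rightarrow>\<^sub>E ground M)"
    using assms by (simp add: finite_PiE)
qed

text \<open>Gives nonemptiness of \<open>Aut M\<close>. The identity is cut down to
  \<open>ground M\<close> because morphisms are extensional.\<close>

lemma id_in_Aut: "restrict id (ground M) \<in> Aut M"
proof -
  have "restrict id (ground M) ` S = S" if "S \<subseteq> ground M" for S
    using that by force
  then show ?thesis
    by (auto simp: Aut_def matroid_morphisms_def bij_betw_def inj_on_def)
qed

lemma compose_Aut:
  assumes "A \<in> Aut M" "B \<in> Aut M"
  shows "compose (ground M) A B \<in> Aut M"
  using assms compose_matroid_morphisms bij_betw_compose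
  unfolding Aut_def by fastforce

text \<open>Since \<open>B\<close> maps onto \<open>ground M\<close>, the composite of
  \<open>A\<close> after \<open>B\<close> determines \<open>A\<close>. An injective self-map of a
  finite set is onto, so no inverse automorphism has to be constructed.\<close>

lemma bij_betw_Aut_right_translation:
  assumes "finite (ground M)" "B \<in> Aut M"
  shows "bij_betw (\<lambda>A. compose (ground M) A B) (Aut M) (Aut M)"
proof -
  have "inj_on (\<lambda>A. compose (ground M) A B) (Aut M)"
  proof (rule inj_onI)
    fix A A'
    assume A: "A \<in> Aut M" and A': "A' \<in> Aut M"
      and eq: "compose (ground M) A B = compose (ground M) A' B"
    show "A = A'"
    proof (rule extensionalityI)
      show "A \<in> extensional (ground M)" "A' \<in> extensional (ground M)"
        using A A' by (auto simp: Aut_def matroid_morphisms_def PiE_def)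
      fix y
      assume "y \<in> ground M"
      then obtain x where "x \<in> ground M" "y = B x"
        using assms(2) by (auto simp: Aut_def bij_betw_def)
      with eq show "A y = A' y"
        by (metis compose_eq)
    qed
  qed
  moreover have "(\<lambda>A. compose (ground M) A B) ` Aut M \<subseteq> Aut M"
    using assms(2) by (auto intro: compose_Aut)
  ultimately show ?thesis
    using finite_Aut[OF assms(1)] by (simp add: bij_betw_def endo_inj_surj)
qed

theorem theorem3:
  fixes C :: "'a matroid set"
    and BigM :: "'b matroid"
    and f :: "'a matroid \<Rightarrow> (nat \<Rightarrow> 'a) \<Rightarrow> 'a \<Rightarrow> 'b"
  assumes "\<And>M. M \<in> C \<Longrightarrow> matroid M"
    and "closed_under_restriction C"
    and "matroid BigM"
    and "online_morphism C BigM f"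
    and "\<And>M \<pi> \<pi>'. \<lbrakk>M \<in> C; \<pi> \<in> orderings M; \<pi>' \<in> orderings M\<rbrakk> \<Longrightarrow>
           \<exists>A\<in>Aut BigM. f M \<pi>' = compose (ground M) A (f M \<pi>)"
  shows "\<exists>F. randomized_online_morphism C BigM F \<and> order_independent C F"
proof -
  define U where "U = pmf_of_set (Aut BigM)"
  define F where "F M \<pi> = map_pmf (\<lambda>A. compose (ground M) A (f M \<pi>)) U" for M \<pi>
  have fin: "finite (ground BigM)"
    using assms(3) by (rule matroid.finite_ground)
  \<comment> \<open>Under these two conditions \<open>U\<close> is the uniform distribution with
    support exactly \<open>Aut BigM\<close>.\<close>
  have Aut: "finite (Aut BigM)" "Aut BigM \<noteq> {}"
    using finite_Aut[OF fin] id_in_Aut by auto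
  have mor: "f M \<pi> \<in> matroid_morphisms M BigM" if "M \<in> C" "\<pi> \<in> orderings M" for M \<pi>
    using assms(4) that by (simp add: online_morphism_def)

  have "set_pmf (F M \<pi>) \<subseteq> matroid_morphisms M BigM"
    if "M \<in> C" "\<pi> \<in> orderings M" for M \<pi>
    using mor[OF that] Aut
    by (auto simp: F_def U_def Aut_def intro: compose_matroid_morphisms)
  moreover have "map_pmf (\<lambda>g. restrict g (ground M')) (F M \<pi>) = F M' \<pi>'"
    if "M \<in> C" "\<pi> \<in> orderings M" "prefix_restriction M' \<pi>' M \<pi>" for M \<pi> M' \<pi>'
  proof -
    have "f M' \<pi>' = restrict (f M \<pi>) (ground M')"
      using assms(4) that by (simp add: online_morphism_def)
    \<comment> \<open>The bound on the prefix length keeps the prefix inside the domain of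
      \<open>\<pi>\<close>. With this inclusion, restricting the composite to
      \<open>ground M'\<close> never meets the default value \<open>undefined\<close> of
      \<open>compose (ground M)\<close>.\<close>
    moreover have "ground M' \<subseteq> ground M"
      using that by (fastforce simp: prefix_restriction_def orderings_def PiE_def Pi_def)
    ultimately have "restrict (compose (ground M) A (f M \<pi>)) (ground M')
        = compose (ground M') A (f M' \<pi>')" for A :: "'b \<Rightarrow> 'b"
      by (auto simp: compose_def restrict_def fun_eq_iff)
    then show ?thesis
      by (simp only: F_def pmf.map_comp o_def)
  qed
  ultimately have "randomized_online_morphism C BigM F"
    by (simp add: randomized_online_morphism_def)

  moreover have "F M \<pi> = F M \<pi>'"
    if M: "M \<in> C" "\<pi> \<in> orderings M" "\<pi>' \<in> orderings M" for M \<pi> \<pi>'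
  proof -
    obtain B where B: "B \<in> Aut BigM" and f': "f M \<pi>' = compose (ground M) B (f M \<pi>)"
      using assms(5)[OF M] by blast
    \<comment> \<open>Needed for associativity: \<open>compose (ground BigM) A B\<close> is
      \<open>undefined\<close> outside \<open>ground BigM\<close>, so \<open>f M \<pi>\<close> must
      take its values there.\<close>
    have "f M \<pi> \<in> ground M \<rightarrow> ground BigM"
      using mor[OF M(1,2)] by (auto simp: matroid_morphisms_def)
    then have "compose (ground M) A (f M \<pi>')
        = compose (ground M) (compose (ground BigM) A B) (f M \<pi>)" for A :: "'b \<Rightarrow> 'b"
      unfolding f' by (rule compose_assoc)
    \<comment> \<open>Splitting the pushforward into two stages isolates the translation by
      \<open>B\<close>, which leaves \<open>U\<close> invariant.\<close>
    then have "F M \<pi>' = map_pmf (\<lambda>A. compose (ground M) A (f M \<pi>))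
        (map_pmf (\<lambda>A. compose (ground BigM) A B) U)"
      by (simp only: F_def pmf.map_comp o_def)
    also have "map_pmf (\<lambda>A. compose (ground BigM) A B) U = U"
      unfolding U_def
      by (intro map_pmf_of_set_bij_betw bij_betw_Aut_right_translation fin B Aut)
    finally show ?thesis
      by (simp add: F_def)
  qed
  then have "order_independent C F"
    unfolding order_independent_def by blast
  ultimately show ?thesis
    by blast
qed

end
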